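(* Let $f$, $\mathbf{C}$, $\mathbf{d}$, $\mathbf{P}$ and $\rho>0$ be as in the context, and assume that $f:\mathbb{R}^{M_V}\to\mathbb{R}$ is convex, differentiable and strictly convex, that $\mathbf{T}_1$ is maximal monotone, and that $\mathrm{fix}(\mathbf{T}_{P,\rho})\neq\emptyset$. Let $\mathbf{x}^*$ be the (unique) primal optimal vector, let $\mathbf{z}^{(0)}\in\mathbb{R}^{M_E}$ be arbitrary, let $(\mathbf{z}^{(k)})_{k\ge0}$ and $(\mathbf{x}^{(k)})_{k\ge1}$ be the auxiliary and primal sequences generated by PDMM from $\mathbf{z}^{(0)}$, and define $$\tilde{\mathbf{z}}_0=\big([\mathbf{C}\ \ \mathbf{P}\mathbf{C}]^T\big)^\dagger\hat{\mathbf{g}}+\Pi_{\ker(\mathbf{C}^T)\cap\ker((\mathbf{P}\mathbf{C})^T)}\,\mathbf{z}^{(0)},\qquad \hat{\mathbf{g}}=\begin{bmatrix}\nabla f(\mathbf{x}^* )+\rho\mathbf{C}^T(\mathbf{C}\mathbf{x}^*-\mathbf{d})\\ \nabla f(\mathbf{x}^* )+\rho\mathbf{C}^T\mathbf{P}(\mathbf{C}\mathbf{x}^*-\mathbf{d})\end{bmatrix},\qquad \tilde{\mathbf{z}}_1=\mathbf{T}_{P,\rho}(\tilde{\mathbf{z}}_0).$$ Then $\mathbf{z}^{(2k)}\to\tilde{\mathbf{z}}_0$ and $\mathbf{z}^{(2k+1)}\to\tilde{\mathbf{z}}_1$ as $k\to\infty$, and $\mathbf{x}^{(k)}\to\mathbf{x}^*$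 as $k\to\infty$.
   Context: $\Gamma_0(\mathbb{R}^n)$ is the set of closed, convex, proper functions $\mathbb{R}^n\to\mathbb{R}\cup\{+\infty\}$; $f^*$ is the Fenchel conjugate; $\Pi_S$ is orthogonal projection onto the subspace $S$; $\dagger$ is the Moore-Penrose pseudo-inverse. Network setting: $\mathbf{G}(V,E)$ is an undirected graph with nodes $V=\{1,\dots,N\}$ and neighbour sets $\mathcal{N}(i)=\{j:(i,j)\in E\}$. Node $i$ has $f_i\in\Gamma_0(\mathbb{R}^{M_i})$. For each edge $(i,j)\in E$ there are matrices $\mathbf{A}_{i|j}\in\mathbb{R}^{M_{ij}\times M_i}$, $\mathbf{A}_{j|i}\in\mathbb{R}^{M_{ij}\times M_j}$ and a vector $\mathbf{b}_{ij}=\mathbf{b}_{ji}\in\mathbb{R}^{M_{ij}}$ (with $M_{ij}=M_{ji}$). The primal problem is $\min\sum_{i}f_i(\mathbf{x}_i)$ subject to $\mathbf{A}_{i|j}\mathbf{x}_i+\mathbf{A}_{j|i}\mathbf{x}_j=\mathbf{b}_{ij}$ for all $(i,j)\in E$; a primal optimal vector is a minimiser of it. Set $M_V=\sum_iM_i$ and $f(\mathbf{x})=\sum_if_i(\mathbf{x}_i)$. Let $M_E=\sum_{i\in V}\sum_{j\in\mathcal{N}(i)}M_{ij}$ (sum over directed edges $i|j$), and index vectors in $\mathbb{R}^{M_E}$ by blocks $\boldsymbol{\lambda}_{i|j}\in\mathbb{R}^{M_{ij}}$, ordered first by $i$, then by $j$. $\mathbf{C}\in\mathbb{R}^{M_E\times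 M_V}$ is block diagonal with blocks $\mathbf{C}_i$, where $\mathbf{C}_i$ stacks vertically $\mathbf{A}_{i|j}$, $j\in\mathcal{N}(i)$; so $(\mathbf{C}\mathbf{x})_{i|j}=\mathbf{A}_{i|j}\mathbf{x}_i$. $\mathbf{d}\in\mathbb{R}^{M_E}$ has blocks $\mathbf{d}_{i|j}=\tfrac12\mathbf{b}_{ij}$. $\mathbf{P}$ is the symmetric permutation matrix with $(\mathbf{P}\boldsymbol{\lambda})_{i|j}=\boldsymbol{\lambda}_{j|i}$ (so $\mathbf{P}^2=\mathbf{I}$, $\mathbf{P}\mathbf{d}=\mathbf{d}$). PDMM: $\mathbf{T}_1=\mathbf{C}\,\partial f^*(\mathbf{C}^T\,\cdot)-\mathbf{d}$. When $\mathbf{T}_1$ is maximal monotone, the PDMM operator $\mathbf{T}_{P,\rho}=\mathbf{P}\circ(2(\mathbf{I}+\rho\mathbf{T}_1)^{-1}-\mathbf{I})$ is single valued and defined on all of $\mathbb{R}^{M_E}$. PDMM generates, for $k\ge0$, $\mathbf{x}^{(k+1)}=\arg\min_{\mathbf{x}}\big(f(\mathbf{x})-\langle\mathbf{C}^T\mathbf{z}^{(k)},\mathbf{x}\rangle+\frac{\rho}{2}\|\mathbf{C}\mathbf{x}-\mathbf{d}\|^2\big)$, $\ \boldsymbol{\lambda}^{(k+1)}=\mathbf{z}^{(k)}-\rho(\mathbf{C}\mathbf{x}^{(k+1)}-\mathbf{d})$, $\ \mathbf{z}^{(k+1)}=\mathbf{P}(2\boldsymbol{\lambda}^{(k+1)}-\mathbf{z}^{(k)})$,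 which is the iteration $\mathbf{z}^{(k+1)}=\mathbf{T}_{P,\rho}(\mathbf{z}^{(k)})$. *)

theory Defs
  imports "Jordan_Normal_Form.Matrix" "HOL-Analysis.Analysis"
begin

no_notation scalar_prod (infix \<open>\<bullet>\<close> 70)
no_notation vec_index (infixl \<open>$\<close> 100)
notation vec_index (infixl \<open>$v\<close> 100)

section \<open>Convex analysis and linear algebra\<close>

text \<open>
  Closed, convex, proper functions on \<open>\<real>\<^sup>n\<close>, where \<open>\<real>\<^sup>n\<close> is \<open>carrier_vec n\<close>. Closed means that the
  epigraph is closed; \<open>X \<rightarrow> x\<close> in \<open>\<real>\<^sup>n\<close> is coordinatewise convergence.
\<close>

definition Gamma0 :: "nat \<Rightarrow> (real Matrix.vec \<Rightarrow> ereal) set" where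
  "Gamma0 n = {g.
     (\<forall>x\<in>carrier_vec n. g x \<noteq> -\<infinity>) \<and> (\<exists>x\<in>carrier_vec n. g x \<noteq> \<infinity>) \<and>
     (\<forall>x\<in>carrier_vec n. \<forall>y\<in>carrier_vec n. \<forall>t::real. 0 < t \<and> t < 1 \<longrightarrow>
        g ((1 - t) \<cdot>\<^sub>v x + t \<cdot>\<^sub>v y) \<le> ereal (1 - t) * g x + ereal t * g y) \<and>
     (\<forall>X r x s. (\<forall>k::nat. X k \<in> carrier_vec n \<and> g (X k) \<le> ereal (r k)) \<and>
        x \<in> carrier_vec n \<and> (\<forall>m<n. (\<lambda>k. X k $v m) \<longlonglongrightarrow> x $v m) \<and> r \<longlonglongrightarrow> s \<longrightarrow>
        g x \<le> ereal s)}"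

definition strictly_convex :: "('a::real_vector \<Rightarrow> real) \<Rightarrow> bool" where
  "strictly_convex g \<longleftrightarrow> (\<forall>x y t. x \<noteq> y \<and> 0 < t \<and> t < 1 \<longrightarrow>
     g ((1 - t) *\<^sub>R x + t *\<^sub>R y) < (1 - t) * g x + t * g y)"

definition fenchel_conjugate :: "('a::real_inner \<Rightarrow> ereal) \<Rightarrow> 'a \<Rightarrow> ereal" where
  "fenchel_conjugate g y = (SUP x. ereal (y \<bullet> x) - g x)"

definition subdifferential :: "('a::real_inner \<Rightarrow> ereal) \<Rightarrow> 'a \<Rightarrow> 'a set" where
  "subdifferential g y = {u. \<forall>w. g w \<ge> g y + ereal (u \<bullet> (w - y))}"

definition gradient :: "('a::real_inner \<Rightarrow> real) \<Rightarrow> 'a \<Rightarrow> 'a" where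
  "gradient g x = (THE D. GDERIV g x :> D)"

text \<open>Set-valued operators are functions \<open>T :: 'a \<Rightarrow> 'a set\<close>.\<close>

definition monotone_operator :: "('a::real_inner \<Rightarrow> 'a set) \<Rightarrow> bool" where
  "monotone_operator T \<longleftrightarrow> (\<forall>x y. \<forall>u\<in>T x. \<forall>v\<in>T y. (u - v) \<bullet> (x - y) \<ge> 0)"

definition maximal_monotone :: "('a::real_inner \<Rightarrow> 'a set) \<Rightarrow> bool" where
  "maximal_monotone T \<longleftrightarrow> monotone_operator T \<and>
     (\<forall>S. monotone_operator S \<and> (\<forall>x. T x \<subseteq> S x) \<longrightarrow> S = T)"

definition resolvent :: "real \<Rightarrow> ('a::real_inner \<Rightarrow> 'a set) \<Rightarrow> 'a \<Rightarrow> 'a set" where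
  "resolvent \<rho> T z = {l. \<exists>t\<in>T l. z = l + \<rho> *\<^sub>R t}"

definition kernel :: "real^'n^'m \<Rightarrow> (real^'n) set" where
  "kernel A = {x. A *v x = 0}"

definition orth_proj :: "'a::real_inner set \<Rightarrow> 'a \<Rightarrow> 'a" where
  "orth_proj S x = (THE p. p \<in> S \<and> (\<forall>s\<in>S. orthogonal (x - p) s))"

text \<open>The Moore-Penrose inverse, as the unique solution of the four Penrose equations.\<close>

definition pinv :: "real^'n^'m \<Rightarrow> real^'m^'n" where
  "pinv A = (THE X. A ** X ** A = A \<and> X ** A ** X = X \<and>
     transpose (A ** X) = A ** X \<and> transpose (X ** A) = X ** A)"

definition hcat :: "real^'a^'m \<Rightarrow> real^'b^'m \<Rightarrow> real^('a + 'b)^'m" where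
  "hcat A B = (\<chi> r c. case c of Inl a \<Rightarrow> A $ r $ a | Inr b \<Rightarrow> B $ r $ b)"

definition vcat :: "real^'a \<Rightarrow> real^'b \<Rightarrow> real^('a + 'b)" where
  "vcat x y = (\<chi> c. case c of Inl a \<Rightarrow> x $ a | Inr b \<Rightarrow> y $ b)"

section \<open>The network problem\<close>

text \<open>
  The local data live in \<open>\<real>\<^bsup>M\<^sub>i\<^esup>\<close> and \<open>\<real>\<^bsup>M\<^sub>i\<^sub>j\<^esup>\<close>, with dimensions depending on the node or edge, and are
  given by vectors and matrices with explicit dimensions. The stacked spaces \<open>\<real>\<^bsup>M\<^sub>V\<^esup>\<close> and \<open>\<real>\<^bsup>M\<^sub>E\<^esup>\<close> are
  \<open>real^'v\<close> and \<open>real^'e\<close>. The bijection \<open>vcoord\<close> sends a coordinate to \<open>(i, m)\<close>, entry \<open>m\<close> of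
  block \<open>i\<close>; the bijection \<open>ecoord\<close> sends a coordinate to \<open>(i, j, r)\<close>, entry \<open>r\<close> of block \<open>i|j\<close>.
  They are part of the data, so any ordering of the blocks is covered. Local entries are counted
  from \<open>0\<close>.
\<close>

record ('v, 'e) network =
  nnodes :: nat
  edges :: "(nat \<times> nat) set"
  vdim :: "nat \<Rightarrow> nat"
  edim :: "nat \<Rightarrow> nat \<Rightarrow> nat"
  nodefun :: "nat \<Rightarrow> real Matrix.vec \<Rightarrow> ereal"
  Amat :: "nat \<Rightarrow> nat \<Rightarrow> real Matrix.mat"
  bvec :: "nat \<Rightarrow> nat \<Rightarrow> real Matrix.vec"
  vcoord :: "'v \<Rightarrow> nat \<times> nat"
  ecoord :: "'e \<Rightarrow> nat \<times> nat \<times> nat"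

definition nodes :: "('v, 'e) network \<Rightarrow> nat set" where
  "nodes G = {1..nnodes G}"

definition is_network :: "('v::finite, 'e::finite) network \<Rightarrow> bool" where
  "is_network G \<longleftrightarrow>
     edges G \<subseteq> nodes G \<times> nodes G \<and> sym (edges G) \<and>
     (\<forall>i\<in>nodes G. nodefun G i \<in> Gamma0 (vdim G i)) \<and>
     (\<forall>(i, j)\<in>edges G.
        edim G i j = edim G j i \<and>
        Amat G i j \<in> carrier_mat (edim G i j) (vdim G i) \<and>
        bvec G i j \<in> carrier_vec (edim G i j) \<and> bvec G i j = bvec G j i) \<and>
     bij_betw (vcoord G) UNIV {(i, m). i \<in> nodes G \<and> m < vdim G i} \<and>
     bij_betw (ecoord G) UNIV {(i, j, r). (i, j) \<in> edges G \<and> r < edim G i j}"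

definition block :: "('v::finite, 'e) network \<Rightarrow> real^'v \<Rightarrow> nat \<Rightarrow> real Matrix.vec" where
  "block G x i = Matrix.vec (vdim G i) (\<lambda>m. x $ inv_into UNIV (vcoord G) (i, m))"

definition objective :: "('v::finite, 'e) network \<Rightarrow> real^'v \<Rightarrow> ereal" where
  "objective G x = (\<Sum>i\<in>nodes G. nodefun G i (block G x i))"

definition feasible :: "('v::finite, 'e) network \<Rightarrow> real^'v \<Rightarrow> bool" where
  "feasible G x \<longleftrightarrow> (\<forall>(i, j)\<in>edges G.
     Amat G i j *\<^sub>v block G x i + Amat G j i *\<^sub>v block G x j = bvec G i j)"

definition primal_optimal :: "('v::finite, 'e) network \<Rightarrow> real^'v \<Rightarrow> bool" where
  "primal_optimal G x \<longleftrightarrow> is_arg_min (objective G) (feasible G) x"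

definition Cmat :: "('v::finite, 'e::finite) network \<Rightarrow> real^'v^'e" where
  "Cmat G = (\<chi> e v. case (ecoord G e, vcoord G v) of
     ((i, j, r), (i', m)) \<Rightarrow> if i' = i then Amat G i j $$ (r, m) else 0)"

definition dvec :: "('v, 'e::finite) network \<Rightarrow> real^'e" where
  "dvec G = (\<chi> e. case ecoord G e of (i, j, r) \<Rightarrow> bvec G i j $v r / 2)"

definition Pmat :: "('v, 'e::finite) network \<Rightarrow> real^'e^'e" where
  "Pmat G = (\<chi> e e'. case ecoord G e of (i, j, r) \<Rightarrow> if ecoord G e' = (j, i, r) then 1 else 0)"

section \<open>PDMM\<close>

definition T1 :: "('v::finite, 'e::finite) network \<Rightarrow> real^'e \<Rightarrow> (real^'e) set" where
  "T1 G l = (\<lambda>u. Cmat G *v u - dvec G) `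
     subdifferential (fenchel_conjugate (objective G)) (transpose (Cmat G) *v l)"

text \<open>
  When \<^term>\<open>T1 G\<close> is maximal monotone, its resolvent is single valued and everywhere defined, so the
  definite description below denotes its value.
\<close>

definition pdmm_operator ::
    "('v::finite, 'e::finite) network \<Rightarrow> real \<Rightarrow> real^'e \<Rightarrow> real^'e" where
  "pdmm_operator G \<rho> z = Pmat G *v (2 *\<^sub>R (THE l. l \<in> resolvent \<rho> (T1 G) z) - z)"

text \<open>The primal and dual sequences start at index 1; \<open>x 0\<close> and \<open>l 0\<close> are unconstrained.\<close>

definition pdmm_sequences ::
    "('v::finite, 'e::finite) network \<Rightarrow> real \<Rightarrow>
     (nat \<Rightarrow> real^'v) \<Rightarrow> (nat \<Rightarrow> real^'e) \<Rightarrow> (nat \<Rightarrow> real^'e) \<Rightarrow> bool" where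
  "pdmm_sequences G \<rho> x l z \<longleftrightarrow> (\<forall>k.
     x (Suc k) = (ARG_MIN (\<lambda>y. objective G y - ereal ((transpose (Cmat G) *v z k) \<bullet> y)
        + ereal (\<rho> / 2 * (norm (Cmat G *v y - dvec G))\<^sup>2)) y. True) \<and>
     l (Suc k) = z k - \<rho> *\<^sub>R (Cmat G *v x (Suc k) - dvec G) \<and>
     z (Suc k) = Pmat G *v (2 *\<^sub>R l (Suc k) - z k))"

end

theory Submission
  imports Defs
begin

text \<open>
  Since \<open>f\<close> is finite, differentiable and strictly convex, \<open>u \<in> \<partial>f\<^sup>* y\<close> means \<open>\<nabla>f u = y\<close>. Minty's
  theorem then shows that every primal update exists, and that it is the unique \<open>u\<close> with
  \<open>\<nabla>f u = C\<^sup>T (z - \<rho> (C u - d))\<close>. A fixed point of the PDMM operator has primal update \<open>x\<^sup>*\<close>, and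
  the squared distance of the auxiliary iterate to it drops in each step by \<open>4 \<rho>\<close> times the inner
  product of \<open>\<nabla>f u - \<nabla>f x\<^sup>*\<close> and \<open>u - x\<^sup>*\<close>. This product therefore tends to \<open>0\<close>, and strict
  convexity forces the primal iterates to converge to \<open>x\<^sup>*\<close>. A convex differentiable function has a
  continuous gradient, so the optimality conditions give the limit of \<open>A z\<^sub>k\<close> for \<open>A = [C  P C]\<^sup>T\<close>.
  Two steps move \<open>z\<close> within the sum of the ranges of \<open>C\<close> and \<open>P C\<close>, so the component of the even
  iterates in the kernel of \<open>A\<close> never changes. Both pieces together determine the limit of the even
  subsequence, and nonexpansiveness gives that of the odd one.
\<close>

section \<open>Convex analysis\<close>

lemma GDERIV_imp_directional_derivative:
  fixes f :: "'a::real_inner \<Rightarrow> real"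
  assumes "GDERIV f u :> D"
  shows "((\<lambda>t. f (u + t *\<^sub>R e)) has_field_derivative D \<bullet> e) (at 0)"
proof -
  have "((\<lambda>t. u + t *\<^sub>R e) has_derivative (\<lambda>t. t *\<^sub>R e)) (at (0::real))"
    by (auto intro!: derivative_eq_intros)
  moreover have "(f has_derivative (\<lambda>h. h \<bullet> D)) (at (u + 0 *\<^sub>R e))"
    using assms by (simp add: gderiv_def)
  ultimately have "((\<lambda>t. f (u + t *\<^sub>R e)) has_derivative (\<lambda>t. (t *\<^sub>R e) \<bullet> D)) (at 0)"
    by (rule has_derivative_compose)
  moreover have "(\<lambda>t. (t *\<^sub>R e) \<bullet> D) = (*) (D \<bullet> e)"
    by (auto simp: inner_commute)
  ultimately show ?thesis
    unfolding has_field_derivative_def by simp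
qed

text \<open>Restricting \<open>f\<close> to the line through \<open>u\<close> and \<open>y\<close>
  reduces this to the tangent inequality in one variable.\<close>

lemma convex_gradient_le:
  fixes f :: "'a::real_inner \<Rightarrow> real"
  assumes "convex_on UNIV f" and "GDERIV f u :> D"
  shows "f u + D \<bullet> (y - u) \<le> f y"
proof -
  define \<phi> where "\<phi> t = f (u + t *\<^sub>R (y - u))" for t :: real
  have "convex_on UNIV \<phi>"
  proof (rule convex_onI)
    fix t a b :: real assume "0 < t" "t < 1"
    have "u + ((1 - t) *\<^sub>R a + t *\<^sub>R b) *\<^sub>R (y - u)
        = (1 - t) *\<^sub>R (u + a *\<^sub>R (y - u)) + t *\<^sub>R (u + b *\<^sub>R (y - u))"
      by (simp add: algebra_simps)
    then show "\<phi> ((1 - t) *\<^sub>R a + t *\<^sub>R b) \<le> (1 - t) * \<phi> a + t * \<phi> b"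
      unfolding \<phi>_def using convex_onD[OF assms(1), of t] \<open>0 < t\<close> \<open>t < 1\<close> by simp
  qed simp
  moreover have "(\<phi> has_field_derivative D \<bullet> (y - u)) (at 0)"
    unfolding \<phi>_def by (rule GDERIV_imp_directional_derivative[OF assms(2)])
  ultimately have "D \<bullet> (y - u) * (1 - 0) \<le> \<phi> 1 - \<phi> 0"
    by (intro convex_on_imp_above_tangent) auto
  then show ?thesis by (simp add: \<phi>_def)
qed

text \<open>At the midpoint of \<open>u\<close> and \<open>y\<close> the value is strictly below the
  chord but not below the tangent.\<close>

lemma strictly_convex_gradient_less:
  fixes f :: "'a::real_inner \<Rightarrow> real"
  assumes "convex_on UNIV f" and "strictly_convex f" and "GDERIV f u :> D" and "y \<noteq> u"
  shows "f u + D \<bullet> (y - u) < f y"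
proof -
  have "f ((1 - 1/2) *\<^sub>R u + (1/2) *\<^sub>R y) < (1 - 1/2) * f u + (1/2) * f y"
    using assms(2)[unfolded strictly_convex_def, rule_format, of u y "1/2"] assms(4) by auto
  moreover have "f u + D \<bullet> (((1 - 1/2) *\<^sub>R u + (1/2) *\<^sub>R y) - u) \<le> f ((1 - 1/2) *\<^sub>R u + (1/2) *\<^sub>R y)"
    by (rule convex_gradient_le[OF assms(1,3)])
  moreover have "((1 - 1/2) *\<^sub>R u + (1/2) *\<^sub>R y) - u = (1/2) *\<^sub>R (y - u)"
    by (simp add: algebra_simps flip: scaleR_left.add)
  ultimately show ?thesis by simp
qed

text \<open>Subtracting the affine minorant leaves a function with a minimum at \<open>u\<close>, so
  its derivative there vanishes.\<close>

lemma subgradient_eq_gradient: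
  fixes f :: "'a::real_inner \<Rightarrow> real"
  assumes "GDERIV f u :> D" and "\<And>y. f u + s \<bullet> (y - u) \<le> f y"
  shows "s = D"
proof -
  have "((\<lambda>y. f y - s \<bullet> (y - u)) has_derivative (\<lambda>h. h \<bullet> D - s \<bullet> h)) (at u)"
    using assms(1) unfolding gderiv_def by (auto intro!: derivative_eq_intros)
  moreover have "\<forall>y\<in>UNIV. f u - s \<bullet> (u - u) \<le> f y - s \<bullet> (y - u)"
    using assms(2) by (simp add: algebra_simps)
  ultimately have "(\<lambda>h. h \<bullet> D - s \<bullet> h) = (\<lambda>h. 0)"
    by (intro differential_zero_maxmin[of u UNIV "\<lambda>y. f y - s \<bullet> (y - u)"]) auto
  then have "(D - s) \<bullet> D - s \<bullet> (D - s) = 0" by metis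
  then have "(D - s) \<bullet> (D - s) = 0" by (simp add: algebra_simps inner_commute)
  then show ?thesis by simp
qed

text \<open>Makes the definite description in \<open>gradient\<close> legitimate: the adjoint yields
  a vector representing the derivative, and there is only one.\<close>

lemma differentiable_GDERIV_gradient:
  fixes f :: "'a::euclidean_space \<Rightarrow> real"
  assumes "f differentiable (at u)"
  shows "GDERIV f u :> gradient f u"
proof -
  obtain f' where f': "(f has_derivative f') (at u)"
    using assms by (auto simp: differentiable_def)
  then have "linear f'" by (rule has_derivative_linear)
  then have "f' = (\<lambda>h. h \<bullet> adjoint f' 1)"
    using adjoint_works[of f' _ 1] by (auto simp: fun_eq_iff)
  then have ex: "GDERIV f u :> adjoint f' 1"
    using f' by (simp add: gderiv_def)
  moreover have "D = adjoint f' 1" if "GDERIV f u :> D" for D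
  proof -
    have "(\<lambda>h. h \<bullet> D) = (\<lambda>h. h \<bullet> adjoint f' 1)"
      using that ex unfolding gderiv_def by (rule has_derivative_unique)
    then show ?thesis by (metis vector_eq_ldot)
  qed
  ultimately show ?thesis
    unfolding gradient_def by (rule theI)
qed

text \<open>By convexity a difference quotient with positive step bounds the directional derivative
  from above, and for a fixed step it is continuous in the base point. Hence directional derivatives
  are upper semicontinuous; opposite directions give both bounds on each coordinate.\<close>

lemma convex_gradient_tendsto:
  fixes f :: "'a::euclidean_space \<Rightarrow> real" and u :: "nat \<Rightarrow> 'a"
  assumes conv: "convex_on UNIV f" and gr: "\<And>y. GDERIV f y :> gr y" and lim: "u \<longlonglongrightarrow> a"
  shows "(\<lambda>k. gr (u k)) \<longlonglongrightarrow> gr a"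
proof -
  have cont: "isCont f y" for y
    using gr[of y] unfolding gderiv_def by (rule has_derivative_continuous)
  have upper: "eventually (\<lambda>k. gr (u k) \<bullet> e < c) sequentially" if c: "gr a \<bullet> e < c" for e c
  proof -
    define q where "q b t = (f (b + t *\<^sub>R e) - f b) / t" for b and t :: real
    have "((\<lambda>t. f (a + t *\<^sub>R e)) has_field_derivative gr a \<bullet> e) (at 0)"
      by (rule GDERIV_imp_directional_derivative[OF gr])
    then have "(q a \<longlongrightarrow> gr a \<bullet> e) (at 0)"
      by (simp add: DERIV_def q_def[abs_def])
    then have "(q a \<longlongrightarrow> gr a \<bullet> e) (at_right 0)"
      by (rule tendsto_within_subset) simp
    then have "eventually (\<lambda>t. q a t < c) (at_right 0)"
      using c by (rule order_tendstoD)
    then have "eventually (\<lambda>t. q a t < c \<and> t > 0) (at_right 0)"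
      using eventually_at_right_less by (rule eventually_conj)
    then obtain t where t: "q a t < c" "t > 0"
      using eventually_happens'[OF trivial_limit_at_right_real] by blast
    have "(\<lambda>k. q (u k) t) \<longlonglongrightarrow> q a t"
      unfolding q_def using t(2)
      by (intro tendsto_intros isCont_tendsto_compose[OF cont] lim) auto
    then have "eventually (\<lambda>k. q (u k) t < c) sequentially"
      using t(1) by (rule order_tendstoD)
    then show ?thesis
    proof eventually_elim
      case (elim k)
      have "f (u k) + gr (u k) \<bullet> (t *\<^sub>R e) \<le> f (u k + t *\<^sub>R e)"
        using convex_gradient_le[OF conv gr, of "u k" "u k + t *\<^sub>R e"] by simp
      then have "gr (u k) \<bullet> e \<le> q (u k) t"
        using t(2) by (simp add: q_def field_simps)
      with elim show ?case by simp
    qed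
  qed
  show ?thesis
  proof (subst tendsto_componentwise_iff, intro ballI order_tendstoI)
    fix i c assume "c < gr a \<bullet> i"
    then have "gr a \<bullet> (- i) < - c" by simp
    from upper[OF this] show "eventually (\<lambda>k. c < gr (u k) \<bullet> i) sequentially" by simp
  qed (rule upper)
qed

text \<open>The Bregman distance to \<open>a\<close> has a positive minimum on each sphere around
  \<open>a\<close> and, by convexity along rays, does not fall below it outside.\<close>

lemma strictly_convex_bregman_tendsto_zero:
  fixes f :: "'a::euclidean_space \<Rightarrow> real" and u :: "nat \<Rightarrow> 'a"
  assumes conv: "convex_on UNIV f" and strict: "strictly_convex f" and D: "GDERIV f a :> D"
    and cont: "continuous_on UNIV f"
    and lim: "(\<lambda>k. f (u k) - f a - D \<bullet> (u k - a)) \<longlonglongrightarrow> 0"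
  shows "u \<longlonglongrightarrow> a"
proof (rule tendstoI)
  fix e :: real assume e: "e > 0"
  define B where "B y = f y - f a - D \<bullet> (y - a)" for y
  have "continuous_on (sphere a e) B"
    unfolding B_def by (intro continuous_intros continuous_on_subset[OF cont]) auto
  moreover have "sphere a e \<noteq> {}" using e by simp
  ultimately obtain p where p: "p \<in> sphere a e" "\<And>y. y \<in> sphere a e \<Longrightarrow> B p \<le> B y"
    using continuous_attains_inf[OF compact_sphere] by metis
  have "p \<noteq> a" using p(1) e by auto
  then have Bp: "B p > 0"
    using strictly_convex_gradient_less[OF conv strict D] by (fastforce simp: B_def)
  have far: "B p \<le> B y" if y: "e \<le> dist y a" for y
  proof -
    \<comment> \<open>This factor moves \<open>y\<close> radially onto the sphere; \<open>B\<close>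
      is convex and zero at \<open>a\<close>, so the move multiplies its value by at most
      \<open>s\<close>.\<close>
    define s where "s = e / dist y a"
    have s: "0 < s" "s \<le> 1" using y e unfolding s_def by (auto intro!: divide_pos_pos simp: divide_le_eq_1)
    have "a + s *\<^sub>R (y - a) \<in> sphere a e"
      using y e by (auto simp: s_def dist_norm norm_minus_commute)
    then have "B p \<le> B (a + s *\<^sub>R (y - a))" by (rule p(2))
    also have "f (a + s *\<^sub>R (y - a)) \<le> (1 - s) * f a + s * f y"
      using convex_onD[OF conv, of s a y] s by (simp add: algebra_simps)
    then have "B (a + s *\<^sub>R (y - a)) \<le> s * B y"
      by (simp add: B_def algebra_simps)
    also have "\<dots> \<le> B y"
      using s convex_gradient_le[OF conv D, of y] by (simp add: B_def mult_left_le_one_le)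
    finally show ?thesis .
  qed
  have "eventually (\<lambda>k. B (u k) < B p) sequentially"
    using lim Bp unfolding B_def[symmetric] by (rule order_tendstoD)
  then show "eventually (\<lambda>k. dist (u k) a < e) sequentially"
    by eventually_elim (meson far not_le)
qed

text \<open>
  A finite case of the Debrunner-Flor lemma, by duality: averaging the functions
  \<open>(l + v) \<bullet> (l - y)\<close> of \<open>l\<close> with weights that average the triples \<open>(y, v, y \<bullet> v)\<close> to \<open>(Y, V, s)\<close> gives
  a quadratic with minimum \<open>- Q (Y, V, s)\<close>, attained at \<open>(Y - V) / 2\<close>.
\<close>

lemma monotone_finite_set_common_point:
  fixes M :: "('a::euclidean_space \<times> 'a) set"
  assumes fin: "finite M"
    and mono: "\<And>y v y' v'. (y, v) \<in> M \<Longrightarrow> (y', v') \<in> M \<Longrightarrow> 0 \<le> (v - v') \<bullet> (y - y')"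
  shows "\<exists>l. \<forall>(y, v)\<in>M. (l + v) \<bullet> (l - y) \<le> 0"
proof (cases "M = {}")
  case False
  define h :: "'a \<times> 'a \<Rightarrow> 'a \<times> 'a \<times> real" where "h = (\<lambda>(y, v). (y, v, y \<bullet> v))"
  define K where "K = convex hull (h ` M)"
  define Q :: "'a \<times> 'a \<times> real \<Rightarrow> real"
    where "Q p = (norm (fst p - fst (snd p)))\<^sup>2 / 4 + snd (snd p)" for p
  have "compact K" unfolding K_def using fin by (intro finite_imp_compact_convex_hull) simp
  moreover have "K \<noteq> {}" using False by (simp add: K_def)
  moreover have "continuous_on K Q" unfolding Q_def by (intro continuous_intros) auto
  ultimately obtain p where p: "p \<in> K" "\<And>q. q \<in> K \<Longrightarrow> Q p \<le> Q q"
    using continuous_attains_inf by metis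
  obtain Y V s where pe: "p = (Y, V, s)" by (cases p) auto
  \<comment> \<open>Since \<open>h\<close> adjoins the product as a coordinate, monotonicity against
    a fixed pair is an affine inequality on the generators and extends to their convex hull.\<close>
  have halfspace: "q \<in> {r. c \<le> a \<bullet> r}" if "\<And>y v. (y, v) \<in> M \<Longrightarrow> c \<le> a \<bullet> h (y, v)" "q \<in> K" for a c q
  proof -
    have "K \<subseteq> {r. c \<le> a \<bullet> r}"
      unfolding K_def using that(1)
      by (intro hull_minimal convex_halfspace_ge) auto
    then show ?thesis using that(2) by blast
  qed
  have pM: "- (y \<bullet> v) \<le> s - Y \<bullet> v - V \<bullet> y" if "(y, v) \<in> M" for y v
  proof -
    have "p \<in> {r. - (y \<bullet> v) \<le> (- v, - y, 1) \<bullet> r}"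
    proof (rule halfspace[OF _ p(1)])
      fix y' v' assume "(y', v') \<in> M"
      then show "- (y \<bullet> v) \<le> (- v, - y, 1) \<bullet> h (y', v')"
        using mono[OF that, of y' v'] by (simp add: h_def algebra_simps inner_commute)
    qed
    then show ?thesis by (simp add: pe inner_commute)
  qed
  \<comment> \<open>Averaging again, now over the pair held fixed so far, gives
    \<open>2 * (Y \<bullet> V) \<le> 2 * s\<close>.\<close>
  have "p \<in> {r. - s \<le> (- V, - Y, 1) \<bullet> r}"
    by (rule halfspace[OF _ p(1)]) (use pM in \<open>fastforce simp: h_def inner_commute algebra_simps\<close>)
  then have sVY: "Y \<bullet> V \<le> s" by (simp add: pe inner_commute)
  define l where "l = (1/2) *\<^sub>R (Y - V)"
  have "(l + v) \<bullet> (l - y) \<le> 0" if yv: "(y, v) \<in> M" for y v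
  proof -
    define w where "w = (y - v) - (Y - V)"
    \<comment> \<open>\<open>Q\<close> at its minimiser \<open>p\<close> is compared with points of
      the segment towards \<open>h (y, v)\<close>; after division by \<open>t\<close>, the limit at
      0 is the first-order condition.\<close>
    have line: "0 \<le> (l \<bullet> w + (y \<bullet> v - s)) + t * ((norm w)\<^sup>2 / 4)" if t: "0 < t" "t < 1" for t
    proof -
      have "(1 - t) *\<^sub>R p + t *\<^sub>R h (y, v) \<in> K"
        using p(1) yv t unfolding K_def
        by (intro convexD_alt[OF convex_convex_hull]) (auto intro: hull_inc)
      then have "Q p \<le> Q ((1 - t) *\<^sub>R p + t *\<^sub>R h (y, v))" by (rule p(2))
      also have "(1 - t) *\<^sub>R p + t *\<^sub>R h (y, v)
          = ((1 - t) *\<^sub>R Y + t *\<^sub>R y, (1 - t) *\<^sub>R V + t *\<^sub>R v, (1 - t) * s + t * (y \<bullet> v))"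
        by (simp add: pe h_def)
      also have "Q \<dots> = (norm ((Y - V) + t *\<^sub>R w))\<^sup>2 / 4 + s + t * (y \<bullet> v - s)"
        by (simp add: Q_def w_def algebra_simps)
      also have "\<dots> = (norm (Y - V))\<^sup>2 / 4 + s
          + t * ((l \<bullet> w + (y \<bullet> v - s)) + t * ((norm w)\<^sup>2 / 4))"
        by (simp add: l_def power2_norm_eq_inner inner_simps inner_commute field_simps)
      also have "(norm (Y - V))\<^sup>2 / 4 + s = Q p" by (simp add: Q_def pe)
      finally show ?thesis using t by (simp add: zero_le_mult_iff)
    qed
    have "0 \<le> l \<bullet> w + (y \<bullet> v - s)"
    proof (rule tendsto_lowerbound)
      show "((\<lambda>t. (l \<bullet> w + (y \<bullet> v - s)) + t * ((norm w)\<^sup>2 / 4)) \<longlongrightarrow> l \<bullet> w + (y \<bullet> v - s)) (at_right 0)"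
        by (auto intro!: tendsto_eq_intros)
      show "eventually (\<lambda>t. 0 \<le> (l \<bullet> w + (y \<bullet> v - s)) + t * ((norm w)\<^sup>2 / 4)) (at_right 0)"
        using line by (auto simp: eventually_at_right_field intro!: exI[of _ 1])
    qed simp
    moreover have "0 \<le> (Y + V) \<bullet> (Y + V)" by simp
    \<comment> \<open>The three subtracted terms are nonnegative: the first-order condition, a
      square, and the averaged monotonicity inequality.\<close>
    moreover have "(l + v) \<bullet> (l - y)
        = - (l \<bullet> w + (y \<bullet> v - s)) - (Y + V) \<bullet> (Y + V) / 4 - (s - Y \<bullet> V)"
      by (simp add: l_def w_def inner_simps inner_commute field_simps)
    ultimately show ?thesis using sVY by linarith
  qed
  then show ?thesis by blast
qed simp

text \<open>Each condition describes the closed ball with diameter from \<open>- v\<close> to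
  \<open>y\<close>. Balls are compact, so the finite intersection property passes from finite
  subsets to all of \<open>M\<close>.\<close>

lemma monotone_set_common_point:
  fixes M :: "('a::euclidean_space \<times> 'a) set"
  assumes mono: "\<And>y v y' v'. (y, v) \<in> M \<Longrightarrow> (y', v') \<in> M \<Longrightarrow> 0 \<le> (v - v') \<bullet> (y - y')"
  shows "\<exists>l. \<forall>(y, v)\<in>M. (l + v) \<bullet> (l - y) \<le> 0"
proof (cases "M = {}")
  case False
  then obtain m where m: "m \<in> M" by blast
  define F where "F = (\<lambda>(y, v). cball ((1/2) *\<^sub>R (y - v)) (norm (y + v) / 2) :: 'a set)"
  have F: "l \<in> F (y, v) \<longleftrightarrow> (l + v) \<bullet> (l - y) \<le> 0" for l y v
  proof -
    have "l \<in> F (y, v) \<longleftrightarrow> (norm (l - (1/2) *\<^sub>R (y - v)))\<^sup>2 \<le> (norm (y + v) / 2)\<^sup>2"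
      by (simp add: F_def dist_norm norm_minus_commute abs_le_square_iff[symmetric])
    also have "(norm (l - (1/2) *\<^sub>R (y - v)))\<^sup>2 - (norm (y + v) / 2)\<^sup>2 = (l + v) \<bullet> (l - y)"
      by (simp add: power_divide power2_norm_eq_inner inner_simps inner_commute field_simps)
    then have "(norm (l - (1/2) *\<^sub>R (y - v)))\<^sup>2 \<le> (norm (y + v) / 2)\<^sup>2 \<longleftrightarrow> (l + v) \<bullet> (l - y) \<le> 0"
      by linarith
    finally show ?thesis .
  qed
  have "F m \<inter> (\<Inter>i\<in>M. F i) \<noteq> {}"
  proof (rule compact_imp_fip_image)
    show "compact (F m)" by (cases m) (simp add: F_def)
    show "closed (F i)" for i by (cases i) (simp add: F_def)
    fix N assume "finite N" "N \<subseteq> M"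
    then have "\<exists>l. \<forall>(y, v)\<in>insert m N. (l + v) \<bullet> (l - y) \<le> 0"
      using m by (intro monotone_finite_set_common_point mono) auto
    then obtain l where "\<forall>(y, v)\<in>insert m N. l \<in> F (y, v)" by (auto simp: F)
    then have "l \<in> F m \<inter> (\<Inter>i\<in>N. F i)" by auto
    then show "F m \<inter> (\<Inter>i\<in>N. F i) \<noteq> {}" by blast
  qed
  then obtain l where "l \<in> (\<Inter>i\<in>M. F i)" by blast
  then have "\<forall>(y, v)\<in>M. (l + v) \<bullet> (l - y) \<le> 0" by (auto simp flip: F)
  then show ?thesis ..
qed simp

text \<open>A common point \<open>l\<close> for the graph of \<open>\<rho> T - z\<close> makes
  \<open>(z - l) / \<rho>\<close> monotonically related to every pair of \<open>T\<close>; adding it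
  to the graph at \<open>l\<close> preserves monotonicity, so by maximality it was there
  already.\<close>

theorem minty:
  fixes T :: "'a::euclidean_space \<Rightarrow> 'a set"
  assumes "maximal_monotone T" and "\<rho> > 0"
  shows "\<exists>l. l \<in> resolvent \<rho> T z"
proof -
  define M where "M = {(y, \<rho> *\<^sub>R v - z) |y v. v \<in> T y}"
  have mono: "0 \<le> (u - v) \<bullet> (x - y)" if "u \<in> T x" "v \<in> T y" for x y u v
    using assms(1) that by (auto simp: maximal_monotone_def monotone_operator_def)
  have "\<exists>l. \<forall>(y, v)\<in>M. (l + v) \<bullet> (l - y) \<le> 0"
  proof (rule monotone_set_common_point)
    fix y v y' v' assume "(y, v) \<in> M" "(y', v') \<in> M"
    then obtain u u' where u: "u \<in> T y" "v = \<rho> *\<^sub>R u - z" "u' \<in> T y'" "v' = \<rho> *\<^sub>R u' - z"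
      by (auto simp: M_def)
    have "v - v' = \<rho> *\<^sub>R (u - u')" unfolding u(2,4) by (simp add: algebra_simps)
    then show "0 \<le> (v - v') \<bullet> (y - y')"
      using mono[OF u(1,3)] assms(2) by simp
  qed
  then obtain l where l: "\<And>y v. v \<in> T y \<Longrightarrow> (l + (\<rho> *\<^sub>R v - z)) \<bullet> (l - y) \<le> 0"
    by (auto simp: M_def)
  define t where "t = (1 / \<rho>) *\<^sub>R (z - l)"
  have rel: "0 \<le> (t - v) \<bullet> (l - y)" if "v \<in> T y" for y v
  proof -
    have "\<rho> *\<^sub>R (t - v) = - (l + (\<rho> *\<^sub>R v - z))"
      using assms(2) by (simp add: t_def algebra_simps)
    then have "\<rho> * ((t - v) \<bullet> (l - y)) \<ge> 0"
      using l[OF that] by (metis inner_minus_left inner_scaleR_left neg_0_le_iff_le)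
    then show ?thesis using assms(2) by (simp add: zero_le_mult_iff)
  qed
  define S where "S = T(l := insert t (T l))"
  have "monotone_operator S"
    unfolding monotone_operator_def S_def
  proof (intro allI ballI)
    fix x y u v
    assume u: "u \<in> (T(l := insert t (T l))) x" and v: "v \<in> (T(l := insert t (T l))) y"
    have "(u - v) \<bullet> (x - y) = (v - u) \<bullet> (y - x)" by (simp add: algebra_simps)
    then show "0 \<le> (u - v) \<bullet> (x - y)"
      using u v mono[of u x v y] rel[of v y] rel[of u x] by (auto split: if_splits)
  qed
  then have "S = T" using assms(1) by (auto simp: maximal_monotone_def S_def)
  then have "t \<in> T l" unfolding S_def by (metis fun_upd_same insertI1)
  moreover have "z = l + \<rho> *\<^sub>R t" using assms(2) by (simp add: t_def)
  ultimately show ?thesis by (auto simp: resolvent_def)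
qed

text \<open>By the tangent inequality the supremum defining the conjugate at \<open>gr a\<close> is
  attained at \<open>a\<close>, so conjugate values are explicit at gradients.\<close>

lemma subdifferential_conjugate_iff:
  fixes f :: "'a::real_inner \<Rightarrow> real"
  assumes conv: "convex_on UNIV f" and gr: "\<And>y. GDERIV f y :> gr y"
    and F: "\<And>y. F y = ereal (f y)"
  shows "u \<in> subdifferential (fenchel_conjugate F) y \<longleftrightarrow> gr u = y"
proof -
  have ge: "ereal (w \<bullet> a - f a) \<le> fenchel_conjugate F w" for w a
    unfolding fenchel_conjugate_def by (rule SUP_upper2[of a]) (auto simp: F)
  have eq: "fenchel_conjugate F (gr a) = ereal (gr a \<bullet> a - f a)" for a
  proof (rule antisym[OF _ ge])
    show "fenchel_conjugate F (gr a) \<le> ereal (gr a \<bullet> a - f a)"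
      unfolding fenchel_conjugate_def
    proof (rule SUP_least)
      fix b show "ereal (gr a \<bullet> b) - F b \<le> ereal (gr a \<bullet> a - f a)"
        using convex_gradient_le[OF conv gr, of a b] by (simp add: F algebra_simps)
    qed
  qed
  show ?thesis
  proof
    assume "u \<in> subdifferential (fenchel_conjugate F) y"
    \<comment> \<open>The subgradient inequality is tested at \<open>gr u\<close>, where the
      conjugate is known; with the Fenchel-Young bound \<open>ge\<close> at \<open>y\<close> it
      makes \<open>y\<close> a subgradient of \<open>f\<close> at \<open>u\<close>.\<close>
    then have sub: "fenchel_conjugate F y + ereal (u \<bullet> (gr u - y)) \<le> ereal (gr u \<bullet> u - f u)"
      unfolding subdifferential_def eq[symmetric] by blast
    have "f u + y \<bullet> (b - u) \<le> f b" for b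
    proof -
      have "ereal (y \<bullet> b - f b) + ereal (u \<bullet> (gr u - y)) \<le> ereal (gr u \<bullet> u - f u)"
        using ge[of y b] sub by (meson add_right_mono order_trans)
      then show ?thesis by (simp add: algebra_simps inner_commute)
    qed
    then show "gr u = y" using subgradient_eq_gradient[OF gr] by metis
  next
    assume y: "gr u = y"
    have "fenchel_conjugate F y + ereal (u \<bullet> (w - y)) \<le> fenchel_conjugate F w" for w
      using ge[of w u] eq[of u] by (simp add: y algebra_simps inner_commute)
    then show "u \<in> subdifferential (fenchel_conjugate F) y"
      by (simp add: subdifferential_def)
  qed
qed

section \<open>Orthogonal projections and the pseudo-inverse\<close>

declare transpose_matrix_vector [simp del]

lemma inner_transpose_mult:
  fixes A :: "real^'n^'m"
  shows "(transpose A *v x) \<bullet> y = x \<bullet> (A *v y)"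
  by (simp add: transpose_matrix_vector dot_lmul_matrix)

lemma subspace_kernel: "subspace (kernel A)"
  unfolding kernel_def by (rule subspaceI) (auto simp: algebra_simps)

lemma orth_proj_eqI:
  assumes "subspace S" and "p \<in> S" and "\<And>s. s \<in> S \<Longrightarrow> (x - p) \<bullet> s = 0"
  shows "orth_proj S x = p"
  unfolding orth_proj_def
proof (rule the_equality)
  show "p \<in> S \<and> (\<forall>s\<in>S. orthogonal (x - p) s)"
    using assms by (auto simp: orthogonal_def)
next
  fix q assume q: "q \<in> S \<and> (\<forall>s\<in>S. orthogonal (x - q) s)"
  then have "p - q \<in> S" using assms(1,2) by (auto intro: subspace_diff)
  then have "(x - q) \<bullet> (p - q) - (x - p) \<bullet> (p - q) = 0"
    using q assms(3) by (auto simp: orthogonal_def)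
  then have "(p - q) \<bullet> (p - q) = 0" by (simp add: algebra_simps)
  then show "q = p" by simp
qed

lemma
  fixes x :: "'a::euclidean_space"
  assumes "subspace S"
  shows orth_proj_in: "orth_proj S x \<in> S"
    and orth_proj_orthogonal: "s \<in> S \<Longrightarrow> (x - orth_proj S x) \<bullet> s = 0"
proof -
  obtain y w where yw: "y \<in> span S" "\<And>v. v \<in> span S \<Longrightarrow> orthogonal w v" "x = y + w"
    using orthogonal_subspace_decomp_exists[of S x] by metis
  have S: "span S = S" using assms by (simp add: span_eq_iff)
  have "orth_proj S x = y"
    using yw by (intro orth_proj_eqI assms) (auto simp: S orthogonal_def)
  then show "orth_proj S x \<in> S" and "s \<in> S \<Longrightarrow> (x - orth_proj S x) \<bullet> s = 0"
    using yw by (auto simp: S orthogonal_def)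
qed

lemma orth_proj_same:
  assumes "subspace S" and "x \<in> S"
  shows "orth_proj S x = x"
  using assms by (intro orth_proj_eqI) auto

lemma linear_orth_proj:
  fixes S :: "'a::euclidean_space set"
  assumes "subspace S"
  shows "linear (orth_proj S)"
proof (rule linearI)
  fix x y :: 'a and c :: real
  have *: "(x + y) - (orth_proj S x + orth_proj S y) = (x - orth_proj S x) + (y - orth_proj S y)"
    "c *\<^sub>R x - c *\<^sub>R orth_proj S x = c *\<^sub>R (x - orth_proj S x)"
    by (simp_all add: algebra_simps)
  show "orth_proj S (x + y) = orth_proj S x + orth_proj S y"
    by (rule orth_proj_eqI[OF assms])
      (simp_all add: * inner_add_left subspace_add orth_proj_in orth_proj_orthogonal assms)
  show "orth_proj S (c *\<^sub>R x) = c *\<^sub>R orth_proj S x"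
    by (rule orth_proj_eqI[OF assms])
      (simp_all add: * subspace_scale orth_proj_in orth_proj_orthogonal assms)
qed

lemma orth_proj_selfadjoint:
  fixes x y :: "'a::euclidean_space"
  assumes "subspace S"
  shows "orth_proj S x \<bullet> y = x \<bullet> orth_proj S y"
proof -
  have "(y - orth_proj S y) \<bullet> orth_proj S x = 0" "(x - orth_proj S x) \<bullet> orth_proj S y = 0"
    by (simp_all add: assms orth_proj_in orth_proj_orthogonal)
  then show ?thesis by (simp add: inner_diff_left inner_diff_right inner_commute)
qed

lemma transpose_eq_iff_selfadjoint:
  fixes A :: "real^'n^'n"
  shows "transpose A = A \<longleftrightarrow> (\<forall>x y. (A *v x) \<bullet> y = x \<bullet> (A *v y))"
proof
  assume "transpose A = A"
  then show "\<forall>x y. (A *v x) \<bullet> y = x \<bullet> (A *v y)"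
    using inner_transpose_mult[of A] by simp
next
  assume *: "\<forall>x y. (A *v x) \<bullet> y = x \<bullet> (A *v y)"
  have "transpose A *v x = A *v x" for x
  proof -
    have "(transpose A *v x - A *v x) \<bullet> y = 0" for y
      using * by (simp add: inner_diff_left inner_transpose_mult)
    then show ?thesis
      by (metis eq_iff_diff_eq_0 inner_eq_zero_iff)
  qed
  then show "transpose A = A" by (simp add: matrix_eq)
qed

section \<open>The Moore-Penrose inverse\<close>

definition penrose :: "real^'n^'m \<Rightarrow> real^'m^'n \<Rightarrow> bool" where
  "penrose A X \<longleftrightarrow> A ** X ** A = A \<and> X ** A ** X = X \<and>
     transpose (A ** X) = A ** X \<and> transpose (X ** A) = X ** A"

text \<open>\<open>A ** X\<close> and \<open>A ** Y\<close> are symmetric idempotents with the same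
  range, and transposing their product shows that they agree; likewise \<open>X ** A\<close> and
  \<open>Y ** A\<close>.\<close>

lemma penrose_unique:
  assumes "penrose A X" and "penrose A Y"
  shows "X = Y"
proof -
  have X: "A ** X ** A = A" "X ** A ** X = X" "transpose (A ** X) = A ** X" "transpose (X ** A) = X ** A"
    and Y: "A ** Y ** A = A" "Y ** A ** Y = Y" "transpose (A ** Y) = A ** Y" "transpose (Y ** A) = Y ** A"
    using assms by (auto simp: penrose_def)
  have "A ** X = (A ** Y) ** (A ** X)" by (simp add: matrix_mul_assoc Y(1))
  also have "\<dots> = transpose ((A ** X) ** (A ** Y))" by (simp add: matrix_transpose_mul[of "A ** X"] X(3) Y(3))
  also have "\<dots> = A ** Y" by (simp add: matrix_mul_assoc X(1) Y(3))
  finally have AX: "A ** X = A ** Y" .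
  have "X ** A = (X ** A) ** (Y ** A)" by (metis matrix_mul_assoc Y(1))
  also have "\<dots> = transpose ((Y ** A) ** (X ** A))" by (simp add: matrix_transpose_mul[of "Y ** A"] X(4) Y(4))
  also have "\<dots> = Y ** A" by (metis matrix_mul_assoc X(1) Y(4))
  finally have XA: "X ** A = Y ** A" .
  have "X = X ** (A ** X)" by (metis X(2) matrix_mul_assoc)
  also have "\<dots> = Y ** A ** Y" by (metis AX XA matrix_mul_assoc)
  finally show ?thesis by (simp add: Y(2))
qed

text \<open>
  The inverse of \<open>A\<close> restricted to the orthogonal complement of its kernel, precomposed with the
  projection onto the range of \<open>A\<close>, satisfies the Penrose equations.
\<close>

lemma penrose_exists:
  fixes A :: "real^'n^'m"
  shows "\<exists>X. penrose A X"
proof -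
  define N where "N = kernel A"
  define V where "V = {x. \<forall>s\<in>N. x \<bullet> s = 0}"
  define R where "R = range ((*v) A)"
  have N: "subspace N"
    unfolding N_def by (rule subspace_kernel)
  have V: "subspace V"
    unfolding V_def by (rule subspaceI) (auto simp: inner_add_left)
  have R: "subspace R"
    unfolding R_def by (rule linear_subspace_image) auto
  \<comment> \<open>\<open>q\<close> is the orthogonal projection onto \<open>V\<close>: it leaves
    the value of \<open>A\<close> unchanged and lands where \<open>A\<close> is injective.\<close>
  define q where "q x = x - orth_proj N x" for x
  have qV: "q x \<in> V" and Aq: "A *v q x = A *v x" for x
    using orth_proj_in[OF N, of x] orth_proj_orthogonal[OF N, of _ x]
    by (auto simp: q_def V_def N_def kernel_def algebra_simps)
  have inj: "inj_on ((*v) A) V"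
  proof (rule inj_onI)
    fix x y assume xy: "x \<in> V" "y \<in> V" "A *v x = A *v y"
    then have "x - y \<in> N" "x - y \<in> V"
      using subspace_diff[OF V] by (auto simp: N_def kernel_def algebra_simps)
    then have "(x - y) \<bullet> (x - y) = 0" unfolding V_def by blast
    then show "x = y" by simp
  qed
  obtain h where h: "linear h" "\<And>v. v \<in> V \<Longrightarrow> h (A *v v) = v"
    using linear_exists_left_inverse_on[OF matrix_vector_mul_linear V inj] by blast
  define X where "X = matrix (h \<circ> orth_proj R)"
  have "X *v b = h (orth_proj R b)" for b
    unfolding X_def using linear_compose[OF linear_orth_proj[OF R] h(1)]
    by (simp add: matrix_works)
  moreover have "h (A *v x) = q x" for x
    using h(2)[OF qV] by (simp add: Aq)
  moreover have "orth_proj R (A *v x) = A *v x" for x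
    by (rule orth_proj_same[OF R]) (simp add: R_def)
  ultimately have XA: "X *v (A *v x) = q x" for x by simp
  have AX: "A *v (X *v b) = orth_proj R b" for b
  proof -
    obtain x where x: "orth_proj R b = A *v x"
      using orth_proj_in[OF R, of b] by (auto simp: R_def)
    then have "X *v b = q x"
      using \<open>\<And>b. X *v b = h (orth_proj R b)\<close> \<open>\<And>x. h (A *v x) = q x\<close> by simp
    then show ?thesis by (simp add: Aq x)
  qed
  have "A ** X ** A = A"
    by (simp add: matrix_eq XA Aq flip: matrix_vector_mul_assoc)
  moreover have "X ** A ** X = X"
  proof -
    have "X *v (orth_proj R b) = X *v b" for b
      using \<open>\<And>b. X *v b = h (orth_proj R b)\<close> orth_proj_same[OF R orth_proj_in[OF R]] by simp
    then show ?thesis by (simp add: matrix_eq AX flip: matrix_vector_mul_assoc)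
  qed
  moreover have "transpose (A ** X) = A ** X"
    by (simp add: transpose_eq_iff_selfadjoint AX orth_proj_selfadjoint[OF R] flip: matrix_vector_mul_assoc)
  moreover have "transpose (X ** A) = X ** A"
    by (simp add: transpose_eq_iff_selfadjoint XA q_def inner_diff_left inner_diff_right
        orth_proj_selfadjoint[OF N] flip: matrix_vector_mul_assoc)
  ultimately show ?thesis by (auto simp: penrose_def)
qed

lemma penrose_pinv: "penrose A (pinv A)"
proof -
  obtain X where X: "penrose A X" using penrose_exists by blast
  have "pinv A = X"
    unfolding pinv_def penrose_def[symmetric]
    using X by (rule the_equality) (rule penrose_unique[OF _ X])
  with X show ?thesis by simp
qed

text \<open>\<open>pinv A ** A\<close> projects orthogonally onto the complement of the kernel.
  Limits of \<open>A *v z\<close> and of the kernel component thus determine the limit of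
  \<open>z\<close>.\<close>

lemma pinv_plus_orth_proj_kernel:
  fixes A :: "real^'n^'m"
  shows "pinv A *v (A *v z) + orth_proj (kernel A) z = z"
proof -
  have *: "A ** pinv A ** A = A" "transpose (pinv A ** A) = pinv A ** A"
    using penrose_pinv[of A] by (auto simp: penrose_def)
  have "orth_proj (kernel A) z = z - pinv A *v (A *v z)"
  proof (rule orth_proj_eqI[OF subspace_kernel])
    show "z - pinv A *v (A *v z) \<in> kernel A"
      using *(1) by (simp add: kernel_def algebra_simps matrix_vector_mul_assoc matrix_mul_assoc)
    fix s assume "s \<in> kernel A"
    then have "(pinv A ** A) *v s = 0"
      by (simp add: kernel_def flip: matrix_vector_mul_assoc)
    then show "(z - (z - pinv A *v (A *v z))) \<bullet> s = 0"
      using *(2) by (simp add: transpose_eq_iff_selfadjoint matrix_vector_mul_assoc)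
  qed
  then show ?thesis by simp
qed

lemma orth_proj_eq_of_diff_orthogonal:
  fixes x y :: "'a::euclidean_space"
  assumes "subspace S" and "\<And>s. s \<in> S \<Longrightarrow> (x - y) \<bullet> s = 0"
  shows "orth_proj S x = orth_proj S y"
proof -
  have "orth_proj S (x - y) = 0"
    using assms by (intro orth_proj_eqI) (auto simp: subspace_0)
  then show ?thesis by (simp add: linear_diff[OF linear_orth_proj[OF assms(1)]])
qed

section \<open>Stacked vectors and matrices\<close>

lemma transpose_hcat_mult:
  "transpose (hcat A B) *v w = vcat (transpose A *v w) (transpose B *v w)"
  by (auto simp: vec_eq_iff matrix_vector_mult_def transpose_def hcat_def vcat_def
 split: sum.splits)

lemma vcat_eq_0_iff: "vcat x y = 0 \<longleftrightarrow> x = 0 \<and> y = 0"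
  by (auto simp: vec_eq_iff vcat_def split: sum.splits)

lemma kernel_transpose_hcat:
  "kernel (transpose (hcat A B)) = kernel (transpose A) \<inter> kernel (transpose B)"
  by (auto simp: kernel_def transpose_hcat_mult vcat_eq_0_iff)

lemma tendsto_vcat:
  assumes "(f \<longlongrightarrow> a) F" and "(g \<longlongrightarrow> b) F"
  shows "((\<lambda>k. vcat (f k) (g k)) \<longlongrightarrow> vcat a b) F"
proof (rule vec_tendstoI)
  fix i show "((\<lambda>k. vcat (f k) (g k) $ i) \<longlongrightarrow> vcat a b $ i) F"
    by (cases i) (simp_all add: vcat_def tendsto_vec_nth assms)
qed

section \<open>The network matrices\<close>

lemma edges_sym:
  assumes "is_network G" and "(i, j) \<in> edges G"
  shows "(j, i) \<in> edges G"
  using assms by (auto simp: is_network_def dest: symD)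

lemma edim_sym:
  assumes "is_network G" and "(i, j) \<in> edges G"
  shows "edim G j i = edim G i j"
  using assms by (auto simp: is_network_def)

lemma ecoord_in_edges:
  assumes "is_network G" and "ecoord G e = (i, j, r)"
  shows "(i, j) \<in> edges G" and "r < edim G i j"
proof -
  have "ecoord G e \<in> {(i, j, r). (i, j) \<in> edges G \<and> r < edim G i j}"
    using assms(1) by (intro bij_betw_apply[of "ecoord G" UNIV]) (auto simp: is_network_def)
  then show "(i, j) \<in> edges G" and "r < edim G i j" using assms(2) by auto
qed

lemma ecoord_surj:
  assumes "is_network G" and "(i, j) \<in> edges G" and "r < edim G i j"
  obtains e where "ecoord G e = (i, j, r)"
proof -
  have "(i, j, r) \<in> ecoord G ` UNIV"
    using assms by (simp add: is_network_def bij_betw_def)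
  then show ?thesis using that by auto
qed

lemma inj_ecoord: "is_network G \<Longrightarrow> inj (ecoord G)"
  by (simp add: is_network_def bij_betw_def)

section \<open>The permutation exchanging the two directions of an edge\<close>

definition edge_swap :: "('v, 'e) network \<Rightarrow> 'e \<Rightarrow> 'e" where
  "edge_swap G e = (case ecoord G e of (i, j, r) \<Rightarrow> inv_into UNIV (ecoord G) (j, i, r))"

text \<open>Symmetry of the edge set and of \<open>edim\<close> keeps the reversed index in the
  range of \<open>ecoord\<close>, so the inverse in \<open>edge_swap\<close> is genuine.\<close>

lemma ecoord_edge_swap:
  assumes "is_network G" and "ecoord G e = (i, j, r)"
  shows "ecoord G (edge_swap G e) = (j, i, r)"
proof -
  have "(j, i) \<in> edges G" "r < edim G j i"
    using ecoord_in_edges[OF assms] edges_sym[OF assms(1)] edim_sym[OF assms(1)] by auto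
  then obtain e' where "ecoord G e' = (j, i, r)" by (rule ecoord_surj[OF assms(1)])
  then have "(j, i, r) \<in> range (ecoord G)" by (metis rangeI)
  then show ?thesis by (simp add: edge_swap_def assms(2) f_inv_into_f)
qed

lemma edge_swap_edge_swap:
  assumes "is_network G"
  shows "edge_swap G (edge_swap G e) = e"
  by (cases "ecoord G e") (metis assms ecoord_edge_swap inj_ecoord injD)

lemma Pmat_mult_nth:
  assumes "is_network G"
  shows "(Pmat G *v w) $ e = w $ edge_swap G e"
proof -
  obtain i j r where e: "ecoord G e = (i, j, r)" by (cases "ecoord G e") auto
  have "Pmat G $ e $ e' = (if e' = edge_swap G e then 1 else 0)" for e'
    using inj_eq[OF inj_ecoord[OF assms], of e' "edge_swap G e"] ecoord_edge_swap[OF assms e]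
    by (simp add: Pmat_def e)
  then show ?thesis by (simp add: matrix_vector_mult_def if_distrib[of "\<lambda>c. c * _"] cong: if_cong)
qed

lemma Pmat_involutive: "is_network G \<Longrightarrow> Pmat G *v (Pmat G *v w) = w"
  by (simp add: vec_eq_iff Pmat_mult_nth edge_swap_edge_swap)

lemma transpose_Pmat:
  assumes "is_network G"
  shows "transpose (Pmat G) = Pmat G"
  unfolding transpose_eq_iff_selfadjoint
proof (intro allI)
  fix w v :: "real^'b"
  show "(Pmat G *v w) \<bullet> v = w \<bullet> (Pmat G *v v)"
    unfolding inner_vec_def Pmat_mult_nth[OF assms]
    by (rule sum.reindex_bij_witness[of _ "edge_swap G" "edge_swap G"])
      (auto simp: edge_swap_edge_swap[OF assms])
qed

lemma Pmat_dvec: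
  assumes "is_network G"
  shows "Pmat G *v dvec G = dvec G"
proof -
  have "dvec G $ edge_swap G e = dvec G $ e" for e
  proof -
    obtain i j r where e: "ecoord G e = (i, j, r)" by (cases "ecoord G e") auto
    then have "bvec G i j = bvec G j i"
      using assms ecoord_in_edges(1)[OF assms e] by (auto simp: is_network_def)
    then show ?thesis by (simp add: dvec_def e ecoord_edge_swap[OF assms e])
  qed
  then show ?thesis by (simp add: vec_eq_iff Pmat_mult_nth[OF assms])
qed

section \<open>The constraint matrix and feasibility\<close>

lemma Cmat_mult_nth:
  assumes "is_network G" and e: "ecoord G e = (i, j, r)"
  shows "(Cmat G *v x) $ e = (Amat G i j *\<^sub>v block G x i) $v r"
proof -
  have ij: "(i, j) \<in> edges G" "r < edim G i j" using ecoord_in_edges[OF assms] by auto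
  have A: "Amat G i j \<in> carrier_mat (edim G i j) (vdim G i)" and i: "i \<in> nodes G"
    using assms(1) ij(1) by (auto simp: is_network_def)
  have vc: "bij_betw (vcoord G) UNIV {(i, m). i \<in> nodes G \<and> m < vdim G i}"
    using assms(1) by (simp add: is_network_def)
  \<comment> \<open>Row \<open>e\<close> is supported on the coordinates of node \<open>i\<close>;
    these are then renumbered by their local index \<open>m\<close>.\<close>
  have "(Cmat G *v x) $ e
      = (\<Sum>v\<in>UNIV. if fst (vcoord G v) = i then Amat G i j $$ (r, snd (vcoord G v)) * x $ v else 0)"
    by (simp add: matrix_vector_mult_def Cmat_def e split_beta if_distrib[of "\<lambda>c. c * _"] cong: if_cong)
  also have "\<dots> = (\<Sum>v | fst (vcoord G v) = i. Amat G i j $$ (r, snd (vcoord G v)) * x $ v)"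
    by (simp add: sum.If_cases)
  also have "\<dots> = (\<Sum>m<vdim G i. Amat G i j $$ (r, m) * x $ inv_into UNIV (vcoord G) (i, m))"
  proof (rule sum.reindex_bij_witness[of _ "\<lambda>m. inv_into UNIV (vcoord G) (i, m)" "\<lambda>v. snd (vcoord G v)"])
    fix v assume v: "v \<in> {v. fst (vcoord G v) = i}"
    then have "vcoord G v = (i, snd (vcoord G v))" by (auto simp: prod_eq_iff)
    then show inv: "inv_into UNIV (vcoord G) (i, snd (vcoord G v)) = v"
      using vc by (metis bij_betw_def inv_f_f)
    show "snd (vcoord G v) \<in> {..<vdim G i}"
      using v bij_betw_apply[OF vc, of v] by auto
    show "Amat G i j $$ (r, snd (vcoord G v)) * x $ inv_into UNIV (vcoord G) (i, snd (vcoord G v))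
        = Amat G i j $$ (r, snd (vcoord G v)) * x $ v"
      by (simp add: inv)
  next
    fix m assume m: "m \<in> {..<vdim G i}"
    then have "(i, m) \<in> range (vcoord G)" using vc i by (simp add: bij_betw_def)
    then have "vcoord G (inv_into UNIV (vcoord G) (i, m)) = (i, m)" by (rule f_inv_into_f)
    then show "snd (vcoord G (inv_into UNIV (vcoord G) (i, m))) = m"
      and "inv_into UNIV (vcoord G) (i, m) \<in> {v. fst (vcoord G v) = i}" by auto
  qed
  also have "\<dots> = (Amat G i j *\<^sub>v block G x i) $v r"
    using A ij(2) by (simp add: scalar_prod_def block_def lessThan_atLeast0)
  finally show ?thesis .
qed

text \<open>Adding the swapped residual pairs \<open>i|j\<close> with \<open>j|i\<close>, and the
  two halves of \<open>b\<close> in \<open>dvec\<close> add up to the full right-hand side.\<close>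

lemma feasible_iff:
  assumes "is_network G"
  shows "feasible G x \<longleftrightarrow>
    (Cmat G *v x - dvec G) + Pmat G *v (Cmat G *v x - dvec G) = 0" (is "_ \<longleftrightarrow> ?r = 0")
proof -
  have r: "?r $ e = (Amat G i j *\<^sub>v block G x i) $v r + (Amat G j i *\<^sub>v block G x j) $v r - bvec G i j $v r"
    if e: "ecoord G e = (i, j, r)" for e i j r
  proof -
    have "?r $ e = (Cmat G *v x) $ e + (Cmat G *v x) $ edge_swap G e - 2 * dvec G $ e"
      by (simp add: Pmat_dvec[OF assms] Pmat_mult_nth[OF assms] algebra_simps)
    then show ?thesis
      by (simp add: Cmat_mult_nth[OF assms e] Cmat_mult_nth[OF assms ecoord_edge_swap[OF assms e]]
          dvec_def e)
  qed
  have dims: "Amat G i j \<in> carrier_mat (edim G i j) (vdim G i)"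
    "Amat G j i \<in> carrier_mat (edim G i j) (vdim G j)" "bvec G i j \<in> carrier_vec (edim G i j)"
    if "(i, j) \<in> edges G" for i j
    using assms that edges_sym[OF assms that] edim_sym[OF assms that]
    unfolding is_network_def by (auto simp: split_beta)
  show ?thesis
  proof
    assume feas: "feasible G x"
    have "?r $ e = 0" for e
    proof -
      obtain i j r where e: "ecoord G e = (i, j, r)" by (cases "ecoord G e") auto
      note ij = ecoord_in_edges[OF assms e]
      have "Amat G i j *\<^sub>v block G x i + Amat G j i *\<^sub>v block G x j = bvec G i j"
        using feas ij(1) by (auto simp: feasible_def)
      then have "(Amat G i j *\<^sub>v block G x i + Amat G j i *\<^sub>v block G x j) $v r = bvec G i j $v r"
        by simp
      then show ?thesis
        using ij(2) dims[OF ij(1)] unfolding r[OF e] by simp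
    qed
    then show "?r = 0" by (simp add: vec_eq_iff)
  next
    assume "?r = 0"
    show "feasible G x"
      unfolding feasible_def
    proof clarify
      fix i j assume ij: "(i, j) \<in> edges G"
      show "Amat G i j *\<^sub>v block G x i + Amat G j i *\<^sub>v block G x j = bvec G i j"
      proof (rule eq_vecI)
        fix r assume "r < dim_vec (bvec G i j)"
        then have rd: "r < edim G i j" using dims[OF ij] by simp
        then obtain e where "ecoord G e = (i, j, r)" by (rule ecoord_surj[OF assms ij])
        from r[OF this] \<open>?r = 0\<close>
        show "(Amat G i j *\<^sub>v block G x i + Amat G j i *\<^sub>v block G x j) $v r = bvec G i j $v r"
          using rd dims[OF ij] by simp
      qed (use dims[OF ij] in simp)
    qed
  qed
qed

section \<open>Convergence of PDMM\<close>

locale pdmm =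
  fixes C :: "real^'v^'e" and d :: "real^'e" and P :: "real^'e^'e"
    and f :: "real^'v \<Rightarrow> real" and gr :: "real^'v \<Rightarrow> real^'v" and \<rho> :: real
  assumes P_involutive: "\<And>w. P *v (P *v w) = w" and transpose_P: "transpose P = P"
    and convex: "convex_on UNIV f" and strict: "strictly_convex f"
    and gr: "\<And>y. GDERIV f y :> gr y" and rho: "\<rho> > 0"
begin

text \<open>Stationarity of the primal update, kept as a relation so that existence, supplied by
  Minty's theorem, is separate from uniqueness.\<close>

definition primal_step :: "real^'e \<Rightarrow> real^'v \<Rightarrow> bool" where
  "primal_step w u \<longleftrightarrow> gr u = transpose C *v (w - \<rho> *\<^sub>R (C *v u - d))"

definition aux_step :: "real^'e \<Rightarrow> real^'v \<Rightarrow> real^'e" where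
  "aux_step w u = P *v (w - (2 * \<rho>) *\<^sub>R (C *v u - d))"

definition aug_lagrangian :: "real^'e \<Rightarrow> real^'v \<Rightarrow> real" where
  "aug_lagrangian w y = f y - (transpose C *v w) \<bullet> y + \<rho> / 2 * (norm (C *v y - d))\<^sup>2"

lemma P_selfadjoint: "(P *v w) \<bullet> v = w \<bullet> (P *v v)"
  using transpose_P by (simp add: transpose_eq_iff_selfadjoint)

lemma norm_P: "norm (P *v w) = norm w"
  by (simp add: norm_eq_sqrt_inner P_selfadjoint P_involutive)

text \<open>Links the Bregman distance to the quantity that one step removes from the squared
  distance of auxiliary points.\<close>

lemma bregman_le_gradient_diff:
  "f u - f v - gr v \<bullet> (u - v) \<le> (gr u - gr v) \<bullet> (u - v)"
  using convex_gradient_le[OF convex gr, of u v] by (simp add: algebra_simps)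

lemma gradient_mono: "0 \<le> (gr u - gr v) \<bullet> (u - v)"
  using convex_gradient_le[OF convex gr, of u v] convex_gradient_le[OF convex gr, of v u]
  by (simp add: algebra_simps)

text \<open>When the penalty is expanded exactly around \<open>u\<close>, stationarity cancels the
  linear terms; the strict gradient gap and a nonnegative square remain.\<close>

lemma primal_step_minimal:
  assumes "primal_step w u" and "y \<noteq> u"
  shows "aug_lagrangian w u < aug_lagrangian w y"
proof -
  have "f u + gr u \<bullet> (y - u) < f y"
    by (rule strictly_convex_gradient_less[OF convex strict gr assms(2)])
  moreover have "gr u \<bullet> (y - u) = (transpose C *v w) \<bullet> (y - u) - \<rho> * ((C *v u - d) \<bullet> (C *v (y - u)))"
    using assms(1) unfolding primal_step_def by (simp add: inner_transpose_mult inner_diff_left)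
  moreover have "\<rho> / 2 * (norm (C *v y - d))\<^sup>2 = \<rho> / 2 * (norm (C *v u - d))\<^sup>2
      + \<rho> * ((C *v u - d) \<bullet> (C *v (y - u))) + \<rho> / 2 * (norm (C *v (y - u)))\<^sup>2"
  proof -
    have "C *v y - d = (C *v u - d) + C *v (y - u)" by (simp add: algebra_simps)
    then have "(norm (C *v y - d))\<^sup>2
        = (norm (C *v u - d))\<^sup>2 + 2 * ((C *v u - d) \<bullet> (C *v (y - u))) + (norm (C *v (y - u)))\<^sup>2"
      by (simp only: power2_norm_eq_inner inner_add_left inner_add_right) (simp add: inner_commute)
    then show ?thesis by (simp only: distrib_left)
  qed
  moreover have "0 \<le> \<rho> / 2 * (norm (C *v (y - u)))\<^sup>2" using rho by simp
  ultimately show ?thesis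
    unfolding aug_lagrangian_def inner_diff_right by linarith
qed

lemma primal_step_unique: "primal_step w u \<Longrightarrow> primal_step w v \<Longrightarrow> u = v"
  by (metis primal_step_minimal less_asym)

text \<open>\<open>P\<close> is an isometry, and by stationarity, moving \<open>C\<close> across the
  inner product turns the cross term into the gradient term.\<close>

lemma norm_aux_step_diff:
  assumes "primal_step w u" and "primal_step w' v"
  shows "(norm (aux_step w u - aux_step w' v))\<^sup>2
      = (norm (w - w'))\<^sup>2 - 4 * \<rho> * ((gr u - gr v) \<bullet> (u - v))"
proof -
  define b where "b = C *v (u - v)"
  have "aux_step w u - aux_step w' v = P *v ((w - w') - (2 * \<rho>) *\<^sub>R b)"
    by (simp add: aux_step_def b_def algebra_simps)
  then have "(norm (aux_step w u - aux_step w' v))\<^sup>2 = (norm ((w - w') - (2 * \<rho>) *\<^sub>R b))\<^sup>2"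
    by (simp add: norm_P)
  also have "\<dots> = (norm (w - w'))\<^sup>2 - 4 * \<rho> * (((w - w') - \<rho> *\<^sub>R b) \<bullet> b)"
    by (simp add: power2_norm_eq_inner inner_diff_left inner_diff_right inner_commute algebra_simps)
  also have "gr u - gr v = transpose C *v ((w - w') - \<rho> *\<^sub>R b)"
    using assms by (simp add: primal_step_def b_def algebra_simps)
  then have "((w - w') - \<rho> *\<^sub>R b) \<bullet> b = (gr u - gr v) \<bullet> (u - v)"
    by (simp add: inner_transpose_mult b_def)
  finally show ?thesis .
qed

lemma aux_step_nonexpansive:
  assumes "primal_step w u" and "primal_step w' v"
  shows "norm (aux_step w u - aux_step w' v) \<le> norm (w - w')"
proof (rule power2_le_imp_le)
  show "(norm (aux_step w u - aux_step w' v))\<^sup>2 \<le> (norm (w - w'))\<^sup>2"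
    unfolding norm_aux_step_diff[OF assms] using rho gradient_mono by simp
qed simp

text \<open>
  For a fixed point \<open>w\<close>, the vector \<open>\<lambda> - P \<lambda>\<close> with \<open>\<lambda> = w - \<rho> (C u - d)\<close> is both in the
  \<open>-1\<close>-eigenspace and in the \<open>1\<close>-eigenspace of \<open>P\<close>.
\<close>

lemma fixed_point_feasible_optimal:
  assumes "primal_step w u" and "aux_step w u = w"
  shows "(C *v u - d) + P *v (C *v u - d) = 0"
    and "(C *v y - d) + P *v (C *v y - d) = 0 \<Longrightarrow> y \<noteq> u \<Longrightarrow> f u < f y"
proof -
  define c where "c = C *v u - d"
  define m where "m = w - \<rho> *\<^sub>R c"
  have Pw: "P *v w = w - (2 * \<rho>) *\<^sub>R c"
    using P_involutive[of "w - (2 * \<rho>) *\<^sub>R c"] assms(2) by (simp add: aux_step_def c_def)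
  have Pm: "P *v m = m - \<rho> *\<^sub>R (c + P *v c)"
  proof -
    have "(2 * \<rho>) *\<^sub>R c = \<rho> *\<^sub>R c + \<rho> *\<^sub>R c" by (metis mult_2 scaleR_left_distrib)
    then show ?thesis by (simp add: m_def Pw algebra_simps)
  qed
  \<comment> \<open>\<open>P\<close> fixes \<open>c + P *v c\<close>, so each application of
    \<open>P\<close> to \<open>m\<close> subtracts the same vector; two applications restore
    \<open>m\<close>, which forces that vector to vanish.\<close>
  have "P *v (P *v m) = P *v m - \<rho> *\<^sub>R (c + P *v c)"
    by (subst Pm) (simp add: algebra_simps P_involutive)
  then have "m = m - \<rho> *\<^sub>R (c + P *v c) - \<rho> *\<^sub>R (c + P *v c)"
    by (simp only: P_involutive) (simp only: Pm)
  moreover have "q = 0" if "m = m - q - q" for q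
  proof -
    have "2 *\<^sub>R q = m - (m - q - q)" by (simp add: scaleR_2)
    then show ?thesis using that by simp
  qed
  ultimately have "\<rho> *\<^sub>R (c + P *v c) = 0" by blast
  then show c: "(C *v u - d) + P *v (C *v u - d) = 0"
    using rho by (simp add: c_def)
  then have Pm': "P *v m = m" using Pm by (simp add: c_def)
  assume y: "(C *v y - d) + P *v (C *v y - d) = 0" and "y \<noteq> u"
  \<comment> \<open>A feasible displacement satisfies \<open>P *v h = - h\<close> whereas
    \<open>P *v m = m\<close>, so \<open>m\<close> is orthogonal to \<open>h\<close> and
    \<open>gr u\<close> to \<open>y - u\<close>.\<close>
  define h where "h = C *v (y - u)"
  have "h + P *v h = ((C *v y - d) + P *v (C *v y - d)) - ((C *v u - d) + P *v (C *v u - d))"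
    by (simp add: h_def algebra_simps)
  then have "P *v h = - h" unfolding c y by (simp add: eq_neg_iff_add_eq_0 add.commute)
  then have "m \<bullet> h = 0" using P_selfadjoint[of m h] Pm' by simp
  then have "gr u \<bullet> (y - u) = 0"
    using assms(1) unfolding primal_step_def by (simp add: inner_transpose_mult m_def c_def h_def)
  then show "f u < f y"
    using strictly_convex_gradient_less[OF convex strict gr \<open>y \<noteq> u\<close>] by simp
qed

lemma transpose_PC_mult: "transpose (P ** C) *v w = transpose C *v (P *v w)"
  by (simp add: matrix_transpose_mul transpose_P matrix_vector_mul_assoc)

section \<open>Limits of the primal and auxiliary sequences\<close>

context
  fixes w :: "real^'e" and a :: "real^'v" and u :: "nat \<Rightarrow> real^'v" and z :: "nat \<Rightarrow> real^'e"
  assumes fixed: "primal_step w a" "aux_step w a = w"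
    and steps: "\<And>k. primal_step (z k) (u k)" "\<And>k. z (Suc k) = aux_step (z k) (u k)"
begin

text \<open>The squared distances to the fixed point decrease to a limit, so their decrements,
  multiples of \<open>D\<close>, tend to zero, and \<open>D\<close> dominates the Bregman distance
  to \<open>a\<close>.\<close>

lemma primal_tendsto: "u \<longlonglongrightarrow> a"
proof -
  define D where "D k = (gr (u k) - gr a) \<bullet> (u k - a)" for k
  define E where "E k = (norm (z k - w))\<^sup>2" for k
  have E: "E (Suc k) = E k - 4 * \<rho> * D k" for k
    using norm_aux_step_diff[OF steps(1) fixed(1), of k] by (simp add: E_def D_def steps(2) fixed(2))
  have D: "D k = (1 / (4 * \<rho>)) * (E k - E (Suc k))" for k
    using rho by (simp add: E)
  have "decseq E"
    using rho gradient_mono by (intro decseq_SucI) (simp add: E D_def)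
  then obtain L where L: "E \<longlonglongrightarrow> L"
    using decseq_convergent[of E 0] by (auto simp: E_def)
  have "(\<lambda>k. (1 / (4 * \<rho>)) * (E k - E (Suc k))) \<longlonglongrightarrow> (1 / (4 * \<rho>)) * (L - L)"
    by (intro tendsto_intros L LIMSEQ_Suc)
  then have "D \<longlonglongrightarrow> 0" unfolding D[symmetric] by simp
  moreover have "continuous_on UNIV f"
    using gr unfolding gderiv_def
    by (meson continuous_at_imp_continuous_on has_derivative_continuous)
  moreover have "0 \<le> f (u k) - f a - gr a \<bullet> (u k - a)" for k
    using convex_gradient_le[OF convex gr, of a "u k"] by simp
  ultimately show ?thesis
    using bregman_le_gradient_diff[of "u _" a]
    by (intro strictly_convex_bregman_tendsto_zero[OF convex strict gr[of a]]
        tendsto_sandwich[OF _ _ tendsto_const[of 0] \<open>D \<longlonglongrightarrow> 0\<close>]) (auto simp: D_def)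
qed

lemma aux_even_tendsto:
  "(\<lambda>k. z (2 * k)) \<longlonglongrightarrow>
     pinv (transpose (hcat C (P ** C))) *v
       vcat (gr a + \<rho> *\<^sub>R (transpose C *v (C *v a - d)))
            (gr a + \<rho> *\<^sub>R (transpose C *v (P *v (C *v a - d))))
     + orth_proj (kernel (transpose C) \<inter> kernel (transpose (P ** C))) (z 0)"
proof -
  define A where "A = transpose (hcat C (P ** C))"
  define c where "c = C *v a - d"
  have feas: "c + P *v c = 0"
    unfolding c_def by (rule fixed_point_feasible_optimal(1)[OF fixed])
  have lin: "(\<lambda>k. B *v y k) \<longlonglongrightarrow> B *v b" if "y \<longlonglongrightarrow> b"
    for B :: "real^'i^'j" and y :: "nat \<Rightarrow> real^'i" and b
    by (rule bounded_linear.tendsto[OF matrix_vector_mul_bounded_linear that])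
  have u: "u \<longlonglongrightarrow> a" by (rule primal_tendsto)
  have gru: "(\<lambda>k. gr (u k)) \<longlonglongrightarrow> gr a"
    by (rule convex_gradient_tendsto[OF convex gr u])
  have res: "(\<lambda>k. transpose C *v (C *v u k - d)) \<longlonglongrightarrow> transpose C *v c"
    unfolding c_def by (intro lin tendsto_intros u)
  have Cz: "transpose C *v z k = gr (u k) + \<rho> *\<^sub>R (transpose C *v (C *v u k - d))" for k
    using steps(1)[of k] by (simp add: primal_step_def algebra_simps)
  \<comment> \<open>At index \<open>Suc k\<close> the matrix \<open>P\<close> undoes the permutation
    of the last step, and \<open>Cz\<close> then expresses the value through \<open>u k\<close>
    alone.\<close>
  have PCz: "transpose (P ** C) *v z (Suc k) = gr (u k) - \<rho> *\<^sub>R (transpose C *v (C *v u k - d))" for k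
  proof -
    have "P *v z (Suc k) = z k - (2 * \<rho>) *\<^sub>R (C *v u k - d)"
      by (simp add: steps(2) aux_step_def P_involutive)
    moreover have "(2 * \<rho>) *\<^sub>R t = \<rho> *\<^sub>R t + \<rho> *\<^sub>R t" for t :: "real^'v"
      by (metis mult_2 scaleR_left_distrib)
    ultimately show ?thesis
      by (simp add: transpose_PC_mult matrix_vector_mult_diff_distrib Cz matrix_vector_mult_scaleR)
  qed
  have "(\<lambda>k. transpose C *v z (Suc k)) \<longlonglongrightarrow> gr a + \<rho> *\<^sub>R (transpose C *v c)"
    unfolding Cz by (intro tendsto_intros LIMSEQ_Suc[OF gru] LIMSEQ_Suc[OF res])
  moreover have "(\<lambda>k. transpose (P ** C) *v z (Suc k)) \<longlonglongrightarrow> gr a - \<rho> *\<^sub>R (transpose C *v c)"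
    unfolding PCz by (intro tendsto_intros gru res)
  \<comment> \<open>Feasibility of \<open>a\<close> reverses the sign of \<open>c\<close> under
    \<open>P\<close>, which brings the limit into the form of the second block.\<close>
  moreover have "gr a - \<rho> *\<^sub>R (transpose C *v c) = gr a + \<rho> *\<^sub>R (transpose C *v (P *v c))"
  proof -
    have "P *v c = - c" using feas by (simp add: eq_neg_iff_add_eq_0 add.commute)
    then have "transpose C *v (P *v c) = - (transpose C *v c)"
      using matrix_vector_mult_scaleR[of "transpose C" "-1" c] by simp
    then show ?thesis by simp
  qed
  ultimately have "(\<lambda>k. A *v z (Suc k)) \<longlonglongrightarrow>
      vcat (gr a + \<rho> *\<^sub>R (transpose C *v c)) (gr a + \<rho> *\<^sub>R (transpose C *v (P *v c)))"
    unfolding A_def transpose_hcat_mult by (intro tendsto_vcat) simp_all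
  then have Az: "(\<lambda>k. A *v z k) \<longlonglongrightarrow>
      vcat (gr a + \<rho> *\<^sub>R (transpose C *v c)) (gr a + \<rho> *\<^sub>R (transpose C *v (P *v c)))"
    by (rule LIMSEQ_imp_Suc)
  have "orth_proj (kernel A) (z (Suc (Suc k))) = orth_proj (kernel A) (z k)" for k
  proof (rule orth_proj_eq_of_diff_orthogonal[OF subspace_kernel])
    fix s assume "s \<in> kernel A"
    then have s: "transpose C *v s = 0" "transpose C *v (P *v s) = 0"
      unfolding A_def kernel_transpose_hcat by (auto simp: kernel_def transpose_PC_mult)
    have Cs: "(C *v y) \<bullet> s = 0" "(P *v (C *v y)) \<bullet> s = 0" for y
      using s inner_transpose_mult[of C s y] inner_transpose_mult[of C "P *v s" y]
      by (simp_all add: inner_commute P_selfadjoint)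
    \<comment> \<open>Each residual is \<open>c\<close> plus an element of the range of
      \<open>C\<close>. The constant parts combine to a multiple of \<open>c + P *v c\<close>, which
      is zero, and the rest is orthogonal to \<open>s\<close>.\<close>
    have "z (Suc (Suc k)) - z k
        = - ((2 * \<rho>) *\<^sub>R (C *v (u k - a) + P *v (C *v (u (Suc k) - a)))) - (2 * \<rho>) *\<^sub>R (c + P *v c)"
      by (simp add: steps(2) aux_step_def P_involutive c_def matrix_vector_mult_diff_distrib
          matrix_vector_mult_scaleR algebra_simps)
    then show "(z (Suc (Suc k)) - z k) \<bullet> s = 0"
      unfolding feas by (simp add: inner_diff_left inner_add_left Cs)
  qed
  then have proj: "orth_proj (kernel A) (z (2 * k)) = orth_proj (kernel A) (z 0)" for k
    by (induction k) simp_all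
  have "(\<lambda>k. A *v z (2 * k)) \<longlonglongrightarrow>
      vcat (gr a + \<rho> *\<^sub>R (transpose C *v c)) (gr a + \<rho> *\<^sub>R (transpose C *v (P *v c)))"
    using LIMSEQ_subseq_LIMSEQ[OF Az, of "\<lambda>k. 2 * k"] by (simp add: o_def strict_mono_def)
  then have "(\<lambda>k. pinv A *v (A *v z (2 * k)) + orth_proj (kernel A) (z (2 * k))) \<longlonglongrightarrow>
      pinv A *v vcat (gr a + \<rho> *\<^sub>R (transpose C *v c)) (gr a + \<rho> *\<^sub>R (transpose C *v (P *v c)))
      + orth_proj (kernel A) (z 0)"
    unfolding proj by (intro tendsto_intros lin)
  then show ?thesis
    unfolding pinv_plus_orth_proj_kernel by (simp add: A_def c_def kernel_transpose_hcat)
qed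

end

end

section \<open>Transfer to the network\<close>

theorem mainTheorem2:
  fixes G :: "('v::finite, 'e::finite) network"
    and \<rho> :: real
    and f :: "real^'v \<Rightarrow> real"
    and C :: "real^'v^'e" and d :: "real^'e" and P :: "real^'e^'e"
    and xs :: "real^'v" and g :: "real^('v + 'v)"
    and x :: "nat \<Rightarrow> real^'v" and l z :: "nat \<Rightarrow> real^'e"
    and zt0 zt1 :: "real^'e"
  assumes "is_network G" and "\<rho> > 0"
    and "C = Cmat G" and "d = dvec G" and "P = Pmat G"
    and "\<And>y. objective G y = ereal (f y)"
    and "convex_on UNIV f" and "\<And>y. f differentiable (at y)" and "strictly_convex f"
    and "maximal_monotone (T1 G)"
    and "{w. pdmm_operator G \<rho> w = w} \<noteq> {}"
    and "primal_optimal G xs"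
    and "pdmm_sequences G \<rho> x l z"
    and "g = vcat (gradient f xs + \<rho> *\<^sub>R (transpose C *v (C *v xs - d)))
                  (gradient f xs + \<rho> *\<^sub>R (transpose C *v (P *v (C *v xs - d))))"
    and "zt0 = pinv (transpose (hcat C (P ** C))) *v g
               + orth_proj (kernel (transpose C) \<inter> kernel (transpose (P ** C))) (z 0)"
    and "zt1 = pdmm_operator G \<rho> zt0"
  shows "(\<lambda>k. z (2 * k)) \<longlonglongrightarrow> zt0 \<and> (\<lambda>k. z (2 * k + 1)) \<longlonglongrightarrow> zt1 \<and> x \<longlonglongrightarrow> xs"
proof -
  note net = assms(1) and obj = assms(6)
  have gr: "GDERIV f y :> gradient f y" for y
    by (rule differentiable_GDERIV_gradient[OF assms(8)])
  interpret pdmm C d P f "gradient f" \<rho>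
    using assms(2,7,9) gr by unfold_locales (auto simp: assms(5) Pmat_involutive transpose_Pmat net)
  have T1: "t \<in> T1 G m \<longleftrightarrow> (\<exists>u. t = C *v u - d \<and> gradient f u = transpose C *v m)" for t m
    unfolding T1_def assms(3,4)
    using subdifferential_conjugate_iff[where gr = "gradient f", OF assms(7) gr obj] by auto
  \<comment> \<open>Substituting the dual update for \<open>m\<close> turns the inclusion for
    \<open>T1 G\<close> into stationarity of \<open>u\<close>.\<close>
  have resolvent: "m \<in> resolvent \<rho> (T1 G) w \<longleftrightarrow>
      (\<exists>u. primal_step w u \<and> m = w - \<rho> *\<^sub>R (C *v u - d))" for m w
  proof
    assume "m \<in> resolvent \<rho> (T1 G) w"
    then obtain u where "gradient f u = transpose C *v m" "w = m + \<rho> *\<^sub>R (C *v u - d)"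
      by (auto simp: resolvent_def T1)
    then have "primal_step w u \<and> m = w - \<rho> *\<^sub>R (C *v u - d)"
      by (simp add: primal_step_def)
    then show "\<exists>u. primal_step w u \<and> m = w - \<rho> *\<^sub>R (C *v u - d)" ..
  next
    assume "\<exists>u. primal_step w u \<and> m = w - \<rho> *\<^sub>R (C *v u - d)"
    then obtain u where "primal_step w u" and m: "m = w - \<rho> *\<^sub>R (C *v u - d)" by blast
    then have "C *v u - d \<in> T1 G m" by (auto simp: T1 primal_step_def)
    moreover have "w = m + \<rho> *\<^sub>R (C *v u - d)" by (simp add: m)
    ultimately show "m \<in> resolvent \<rho> (T1 G) w" by (auto simp: resolvent_def)
  qed
  have reflection: "2 *\<^sub>R (w - \<rho> *\<^sub>R t) - w = w - (2 * \<rho>) *\<^sub>R t" for w t :: "real^'e"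
    by (simp add: scaleR_2 scaleR_right_diff_distrib)
  have ex_step: "\<exists>u. primal_step w u" for w
    using minty[OF assms(10,2), of w] resolvent by blast
  have operator: "pdmm_operator G \<rho> w = aux_step w u" if "primal_step w u" for w u
  proof -
    have "(THE m. m \<in> resolvent \<rho> (T1 G) w) = w - \<rho> *\<^sub>R (C *v u - d)"
    proof (rule the_equality)
      show "w - \<rho> *\<^sub>R (C *v u - d) \<in> resolvent \<rho> (T1 G) w"
        using that resolvent by blast
      fix m assume "m \<in> resolvent \<rho> (T1 G) w"
      then obtain v where "primal_step w v" "m = w - \<rho> *\<^sub>R (C *v v - d)"
        using resolvent by blast
      then show "m = w - \<rho> *\<^sub>R (C *v u - d)"
        using primal_step_unique[OF that] by simp
    qed
    then show ?thesis
      by (simp only: pdmm_operator_def aux_step_def reflection flip: assms(5))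
  qed
  obtain w where "pdmm_operator G \<rho> w = w" using assms(11) by blast
  moreover obtain a where a: "primal_step w a" using ex_step by blast
  ultimately have w: "aux_step w a = w" by (simp add: operator)
  have "feasible G a"
    using fixed_point_feasible_optimal(1)[OF a w] by (simp add: feasible_iff[OF net] assms(3-5))
  then have "f xs \<le> f a"
    using assms(12) by (auto simp: primal_optimal_def is_arg_min_def obj not_less)
  moreover have "(C *v xs - d) + P *v (C *v xs - d) = 0"
    using assms(12) by (simp add: primal_optimal_def is_arg_min_def feasible_iff[OF net] assms(3-5))
  \<comment> \<open>\<open>xs\<close> is feasible and no worse than \<open>a\<close>, while every
    other feasible point is strictly worse than \<open>a\<close>.\<close>
  ultimately have xs: "xs = a"
    using fixed_point_feasible_optimal(2)[OF a w, of xs] by fastforce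
  have steps: "primal_step (z k) (x (Suc k))" "z (Suc k) = aux_step (z k) (x (Suc k))" for k
  proof -
    obtain u where u: "primal_step (z k) u" using ex_step by blast
    have "(\<lambda>y. objective G y - ereal ((transpose (Cmat G) *v z k) \<bullet> y)
        + ereal (\<rho> / 2 * (norm (Cmat G *v y - dvec G))\<^sup>2)) = (\<lambda>y. ereal (aug_lagrangian (z k) y))"
      by (simp add: obj aug_lagrangian_def fun_eq_iff flip: assms(3,4))
    then have "x (Suc k) = (ARG_MIN (\<lambda>y. ereal (aug_lagrangian (z k) y)) y. True)"
      using assms(13) by (simp add: pdmm_sequences_def)
    \<comment> \<open>Strict minimality leaves \<open>u\<close> as the only value that the choice in
      \<open>ARG_MIN\<close> can take.\<close>
    also have "\<dots> = u"
      unfolding arg_min_def is_arg_min_def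
      using primal_step_minimal[OF u] by (intro some_equality) (auto, metis less_asym)
    finally have xu: "x (Suc k) = u" .
    then show "primal_step (z k) (x (Suc k))" using u by simp
    have "z (Suc k) = P *v (2 *\<^sub>R (z k - \<rho> *\<^sub>R (C *v x (Suc k) - d)) - z k)"
      using assms(13) by (simp add: pdmm_sequences_def assms(3-5))
    then show "z (Suc k) = aux_step (z k) (x (Suc k))"
      by (simp only: aux_step_def reflection)
  qed
  \<comment> \<open>The update from \<open>z k\<close> is \<open>x (Suc k)\<close>; the arbitrary
    entry \<open>x 0\<close> does not affect the limit.\<close>
  have "(\<lambda>k. x (Suc k)) \<longlonglongrightarrow> xs"
    unfolding xs by (rule primal_tendsto[where z = z and u = "\<lambda>k. x (Suc k)", OF a w steps])
  then have x: "x \<longlonglongrightarrow> xs" by (rule LIMSEQ_imp_Suc)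
  have even: "(\<lambda>k. z (2 * k)) \<longlonglongrightarrow> zt0"
    unfolding assms(14,15) xs
    by (rule aux_even_tendsto[where z = z and u = "\<lambda>k. x (Suc k)", OF a w steps])
  obtain u where u: "primal_step zt0 u" using ex_step by blast
  \<comment> \<open>\<open>zt1\<close> is the image of \<open>zt0\<close>, so nonexpansiveness
    bounds each odd distance by the preceding even one.\<close>
  have "(\<lambda>k. z (2 * k + 1)) \<longlonglongrightarrow> zt1"
  proof (rule LIM_zero_cancel, rule Lim_null_comparison)
    show "eventually (\<lambda>k. norm (z (2 * k + 1) - zt1) \<le> norm (z (2 * k) - zt0)) sequentially"
      using aux_step_nonexpansive[OF steps(1) u]
      by (simp add: assms(16) operator[OF u] steps(2))
    show "(\<lambda>k. norm (z (2 * k) - zt0)) \<longlonglongrightarrow> 0"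
      using even by (intro tendsto_norm_zero LIM_zero)
  qed
  with x even show ?thesis by simp
qed

end
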